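(* Let $i$ be the index of a point $\boldsymbol{x}_i$ of the point cloud, let $c_{ij}^\Delta\in\mathbb{R}$ and $\kappa_{ij}\in\mathbb{R}$ for $j\in\mathcal{N}_i$ be the off-diagonal coefficients of a discrete Laplace operator at $\boldsymbol{x}_i$ and the reconstructions of the diffusivity, respectively, and consider the derived diffusion operator with coefficients $$c_{ij}^{\nabla\cdot(\kappa\nabla)}=\kappa_{ij}c_{ij}^\Delta\quad (j\in\mathcal{N}_i),\qquad c_{ii}^{\nabla\cdot(\kappa\nabla)}=-\sum_{j\in\mathcal{N}_i}\kappa_{ij}c_{ij}^\Delta .$$ If $c_{ij}^\Delta\ge 0$ and $\kappa_{ij}>0$ for each $j\in\mathcal{N}_i$, then the derived diffusion operator at $\boldsymbol{x}_i$ is diagonally dominant.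
   Context: $\Omega_h=\{\boldsymbol{x}_1,\dots,\boldsymbol{x}_N\}\subset\Omega\subset\mathbb{R}^d$ is a finite point cloud, $h\colon\Omega\to(0,\infty)$ is the smoothing length, $\mathcal{S}_i=\{j:\|\boldsymbol{x}_j-\boldsymbol{x}_i\|\le h(\boldsymbol{x}_i)\}$ is the stencil of $\boldsymbol{x}_i$ and $\mathcal{N}_i=\mathcal{S}_i\setminus\{i\}$ its set of neighbors. A discrete differential operator $D_i$ at $\boldsymbol{x}_i$ is given by coefficients $c_{ij}^D\in\mathbb{R}$, $j\in\mathcal{S}_i$, acting by $D_iu=\sum_{j\in\mathcal{S}_i}c_{ij}^D u(\boldsymbol{x}_j)$. The derived diffusion operator acts equivalently by $u\mapsto\sum_{j\in\mathcal{N}_i}\kappa_{ij}c_{ij}^\Delta(u(\boldsymbol{x}_j)-u(\boldsymbol{x}_i))$, and approximates $u\mapsto\nabla\cdot(\kappa\nabla u)(\boldsymbol{x}_i)$; the number $\kappa_{ij}$ is an approximation of $\kappa$ at the midpoint $(\boldsymbol{x}_i+\boldsymbol{x}_j)/2$ (only its sign matters here). Definition (diagonal dominance). A discrete differential operator $D_i$ (here one approximating an operator, such as $\nabla\cdot(\kappa\nabla)$, that annihilates constants) is called diagonally dominant if it is consistent for constant functions, i.e. $\sum_{j\in\mathcal{S}_i}c_{ij}^D=0$, and its coefficients satisfy the sign condition $c_{ij}^D c_{ii}^D\le 0$ for all $j\in\mathcal{N}_i$. *)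

theory Defs
  imports "HOL-Analysis.Analysis"
begin

definition point_cloud ::
    "(real ^ 'd) set \<Rightarrow> nat \<Rightarrow> (nat \<Rightarrow> real ^ 'd) \<Rightarrow> (real ^ 'd \<Rightarrow> real) \<Rightarrow> bool" where
  "point_cloud \<Omega> N x h \<longleftrightarrow> (\<forall>j\<in>{1..N}. x j \<in> \<Omega>) \<and> (\<forall>y\<in>\<Omega>. h y > 0)"

definition stencil ::
    "nat \<Rightarrow> (nat \<Rightarrow> real ^ 'd) \<Rightarrow> (real ^ 'd \<Rightarrow> real) \<Rightarrow> nat \<Rightarrow> nat set" where
  "stencil N x h i = {j \<in> {1..N}. norm (x j - x i) \<le> h (x i)}"

definition neighbors ::
    "nat \<Rightarrow> (nat \<Rightarrow> real ^ 'd) \<Rightarrow> (real ^ 'd \<Rightarrow> real) \<Rightarrow> nat \<Rightarrow> nat set" where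
  "neighbors N x h i = stencil N x h i - {i}"

text \<open>
  A discrete differential operator at the point \<open>x i\<close> is represented by its coefficients
  \<open>c :: nat \<Rightarrow> real\<close>, where \<open>c j\<close> belongs to the point \<open>x j\<close>.  Only the values of \<open>c\<close> on
  \<open>stencil N x h i\<close> are meaningful.
\<close>

definition discrete_op ::
    "nat \<Rightarrow> (nat \<Rightarrow> real ^ 'd) \<Rightarrow> (real ^ 'd \<Rightarrow> real) \<Rightarrow> nat \<Rightarrow> (nat \<Rightarrow> real)
      \<Rightarrow> (real ^ 'd \<Rightarrow> real) \<Rightarrow> real" where
  "discrete_op N x h i c u = (\<Sum>j\<in>stencil N x h i. c j * u (x j))"

text \<open>
  Since the coefficient sum is required to vanish, this notion is meant for approximations of
  operators that annihilate constants.  It is a sign condition, not the row-wise inequality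
  that bounds the off-diagonal absolute values by the diagonal one.
\<close>

definition diagonally_dominant ::
    "nat \<Rightarrow> (nat \<Rightarrow> real ^ 'd) \<Rightarrow> (real ^ 'd \<Rightarrow> real) \<Rightarrow> nat \<Rightarrow> (nat \<Rightarrow> real) \<Rightarrow> bool" where
  "diagonally_dominant N x h i c \<longleftrightarrow>
     (\<Sum>j\<in>stencil N x h i. c j) = 0 \<and> (\<forall>j\<in>neighbors N x h i. c j * c i \<le> 0)"

definition derived_diffusion ::
    "nat \<Rightarrow> (nat \<Rightarrow> real ^ 'd) \<Rightarrow> (real ^ 'd \<Rightarrow> real) \<Rightarrow> nat \<Rightarrow> (nat \<Rightarrow> real) \<Rightarrow> (nat \<Rightarrow> real)
      \<Rightarrow> nat \<Rightarrow> real" where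
  "derived_diffusion N x h i \<kappa> c\<Delta> j =
     (if j = i then - (\<Sum>k\<in>neighbors N x h i. \<kappa> k * c\<Delta> k) else \<kappa> j * c\<Delta> j)"

lemma discrete_op_derived_diffusion:
  assumes "point_cloud \<Omega> N x h" and "i \<in> {1..N}"
  shows "discrete_op N x h i (derived_diffusion N x h i \<kappa> c\<Delta>) u =
    (\<Sum>j\<in>neighbors N x h i. \<kappa> j * c\<Delta> j * (u (x j) - u (x i)))"
proof -
  have i: "i \<in> stencil N x h i"
    using assms by (auto simp: stencil_def point_cloud_def less_imp_le)
  have fin: "finite (stencil N x h i)"
    by (simp add: stencil_def)
  have "discrete_op N x h i (derived_diffusion N x h i \<kappa> c\<Delta>) u =
      - (\<Sum>k\<in>neighbors N x h i. \<kappa> k * c\<Delta> k) * u (x i)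
      + (\<Sum>j\<in>neighbors N x h i. derived_diffusion N x h i \<kappa> c\<Delta> j * u (x j))"
    unfolding discrete_op_def neighbors_def
    by (subst sum.remove[OF fin i]) (simp add: derived_diffusion_def neighbors_def)
  also have "(\<Sum>j\<in>neighbors N x h i. derived_diffusion N x h i \<kappa> c\<Delta> j * u (x j)) =
      (\<Sum>j\<in>neighbors N x h i. \<kappa> j * c\<Delta> j * u (x j))"
    by (rule sum.cong) (auto simp: derived_diffusion_def neighbors_def)
  finally show ?thesis
    by (simp add: right_diff_distrib sum_subtractf sum_distrib_right)
qed

end

theory Submission
  imports Defs
begin

text \<open>The off-diagonal coefficients \<open>\<kappa> j * c\<Delta> j\<close> are products of
  nonnegative numbers and the diagonal one is minus their sum, so the two kinds have opposite signs.
  The zero row sum comes from \<open>discrete_op_derived_diffusion\<close>: written in differences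
  of \<open>u\<close>, the operator annihilates constants.\<close>

theorem corollary3p1:
  fixes \<Omega> :: "(real ^ 'd) set"
    and N :: nat
    and x :: "nat \<Rightarrow> real ^ 'd"
    and h :: "real ^ 'd \<Rightarrow> real"
    and i :: nat
    and c\<Delta> \<kappa> :: "nat \<Rightarrow> real"
  assumes "point_cloud \<Omega> N x h"
    and "i \<in> {1..N}"
    and "\<And>j. j \<in> neighbors N x h i \<Longrightarrow> c\<Delta> j \<ge> 0"
    and "\<And>j. j \<in> neighbors N x h i \<Longrightarrow> \<kappa> j > 0"
  shows "diagonally_dominant N x h i (derived_diffusion N x h i \<kappa> c\<Delta>)"
  unfolding diagonally_dominant_def
proof (intro conjI ballI)
  show "(\<Sum>j\<in>stencil N x h i. derived_diffusion N x h i \<kappa> c\<Delta> j) = 0"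
    \<comment> \<open>Applied to the constant 1, the operator returns its coefficient sum, while all
      differences vanish. The assumptions passed on give \<open>h (x i) > 0\<close>, which puts
      \<open>i\<close> in its own stencil, so that the diagonal coefficient is counted.\<close>
    using discrete_op_derived_diffusion[OF assms(1,2), of \<kappa> c\<Delta> "\<lambda>_. 1"]
    by (simp add: discrete_op_def)
next
  fix j
  assume j: "j \<in> neighbors N x h i"
  \<comment> \<open>Needed for every neighbor, not just \<open>j\<close>, because the diagonal
    coefficient sums over all of them.\<close>
  have nonneg: "\<kappa> k * c\<Delta> k \<ge> 0" if "k \<in> neighbors N x h i" for k
    using assms(3,4)[OF that] by simp
  have "j \<noteq> i"
    using j by (simp add: neighbors_def)
  then have "derived_diffusion N x h i \<kappa> c\<Delta> j \<ge> 0"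
    using nonneg[OF j] by (simp add: derived_diffusion_def)
  moreover have "derived_diffusion N x h i \<kappa> c\<Delta> i \<le> 0"
    using nonneg by (simp add: derived_diffusion_def sum_nonneg)
  ultimately show "derived_diffusion N x h i \<kappa> c\<Delta> j * derived_diffusion N x h i \<kappa> c\<Delta> i \<le> 0"
    by (rule mult_nonneg_nonpos)
qed

end
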